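(* For the single-forced multiparticle system $\dot x=f(x)+g^u(x)u$, $u\in\mathbb{R}$, on $\mathbb{R}^{2n}$ (force applied to the first particle), the evaluation $\mathcal{I}^0_x$ of its zero-time ideal satisfies $\dim \mathcal{I}^0_x=2n$ at each point $x\in\mathbb{R}^{2n}$.
   Context: Let $n\ge 2$. $\Phi:\mathbb{R}\to\mathbb{R}$ is a real analytic, bounded below function with $\lim_{y\to+\infty}\Phi(y)=+\infty$, and $\phi=\Phi'$. The state is $x=(q,p)=(q_1,\dots,q_n,p_1,\dots,p_n)\in\mathbb{R}^{2n}$. The drift is the vector field $$f=\sum_{k=1}^{n}p_k\frac{\partial}{\partial q_k}-\phi(q_1-q_2)\frac{\partial}{\partial p_1}+\sum_{k=2}^{n-1}\bigl(\phi(q_{k-1}-q_k)-\phi(q_k-q_{k+1})\bigr)\frac{\partial}{\partial p_k}+\phi(q_{n-1}-q_n)\frac{\partial}{\partial p_n},$$ and $g^u=\frac{\partial}{\partial p_1}$. The Lie bracket of vector fields is $[F^1,F^2]=DF^2\,F^1-DF^1\,F^2$, where $DF$ is the Jacobian matrix. $\mathrm{Lie}\{f,g^u\}$ is the Lie algebra of vector fields generated by $f,g^u$. The zero-time ideal $\mathcal{I}^0$ is the Lie ideal of $\mathrm{Lie}\{f,g^u\}$ generated by $g^u$. $\mathcal{I}^0_x\subseteq\mathbb{R}^{2n}$ is the linear space of values at $x$ of the vector fields from $\mathcal{I}^0$. *)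

theory Defs
  imports "HOL-Analysis.Analysis"
begin

definition real_analytic :: "(real \<Rightarrow> real) \<Rightarrow> bool" where
  "real_analytic \<Phi> \<longleftrightarrow>
     (\<forall>x. \<exists>a. \<exists>r>0. \<forall>y. \<bar>y - x\<bar> < r \<longrightarrow> (\<lambda>k. a k * (y - x) ^ k) sums \<Phi> y)"

(* [F, G] = DG F - DF G, with frechet_derivative F (at x) being multiplication by the Jacobian
   matrix of F at x.  At points where a field is not differentiable the value is arbitrary; all
   fields generated by smooth fields are smooth. *)
definition lie_bracket :: "('a::euclidean_space \<Rightarrow> 'a) \<Rightarrow> ('a \<Rightarrow> 'a) \<Rightarrow> 'a \<Rightarrow> 'a" where
  "lie_bracket F G = (\<lambda>x. frechet_derivative G (at x) (F x) - frechet_derivative F (at x) (G x))"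

inductive_set lie_algebra_generated :: "('a::euclidean_space \<Rightarrow> 'a) set \<Rightarrow> ('a \<Rightarrow> 'a) set"
  for S :: "('a \<Rightarrow> 'a) set" where
  generator: "F \<in> S \<Longrightarrow> F \<in> lie_algebra_generated S"
| zero: "(\<lambda>x. 0) \<in> lie_algebra_generated S"
| add: "F \<in> lie_algebra_generated S \<Longrightarrow> G \<in> lie_algebra_generated S \<Longrightarrow>
    (\<lambda>x. F x + G x) \<in> lie_algebra_generated S"
| scale: "F \<in> lie_algebra_generated S \<Longrightarrow> (\<lambda>x. c *\<^sub>R F x) \<in> lie_algebra_generated S"
| bracket: "F \<in> lie_algebra_generated S \<Longrightarrow> G \<in> lie_algebra_generated S \<Longrightarrow>
    lie_bracket F G \<in> lie_algebra_generated S"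

(* The Lie ideal of the Lie algebra L generated by S, for S a subset of L.  One-sided absorption
   suffices: the bracket is antisymmetric. *)
inductive_set lie_ideal_generated ::
    "('a::euclidean_space \<Rightarrow> 'a) set \<Rightarrow> ('a \<Rightarrow> 'a) set \<Rightarrow> ('a \<Rightarrow> 'a) set"
  for L S :: "('a \<Rightarrow> 'a) set" where
  generator: "F \<in> S \<Longrightarrow> F \<in> lie_ideal_generated L S"
| zero: "(\<lambda>x. 0) \<in> lie_ideal_generated L S"
| add: "F \<in> lie_ideal_generated L S \<Longrightarrow> G \<in> lie_ideal_generated L S \<Longrightarrow>
    (\<lambda>x. F x + G x) \<in> lie_ideal_generated L S"
| scale: "F \<in> lie_ideal_generated L S \<Longrightarrow> (\<lambda>x. c *\<^sub>R F x) \<in> lie_ideal_generated L S"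
| bracket: "F \<in> L \<Longrightarrow> G \<in> lie_ideal_generated L S \<Longrightarrow>
    lie_bracket F G \<in> lie_ideal_generated L S"

definition zero_time_ideal :: "('a::euclidean_space \<Rightarrow> 'a) \<Rightarrow> ('a \<Rightarrow> 'a) \<Rightarrow> ('a \<Rightarrow> 'a) set" where
  "zero_time_ideal f g = lie_ideal_generated (lie_algebra_generated {f, g}) {g}"

(* The phase space R^2n is real^'n \<times> real^'n, a state being x = (q, p).  The particles
   1, ..., n are matched with the coordinates by a bijection e from {1..n} onto 'n, so that
   q_k is fst x $ e k and p_k is snd x $ e k. *)

definition partial_q :: "(nat \<Rightarrow> 'n::finite) \<Rightarrow> nat \<Rightarrow> (real^'n) \<times> (real^'n)" where
  "partial_q e k = (axis (e k) 1, 0)"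

definition partial_p :: "(nat \<Rightarrow> 'n::finite) \<Rightarrow> nat \<Rightarrow> (real^'n) \<times> (real^'n)" where
  "partial_p e k = (0, axis (e k) 1)"

definition chain_drift ::
    "nat \<Rightarrow> (nat \<Rightarrow> 'n::finite) \<Rightarrow> (real \<Rightarrow> real)
      \<Rightarrow> (real^'n) \<times> (real^'n) \<Rightarrow> (real^'n) \<times> (real^'n)" where
  "chain_drift n e \<phi> = (\<lambda>(q, p).
      (\<Sum>k=1..n. (p $ e k) *\<^sub>R partial_q e k)
      - \<phi> (q $ e 1 - q $ e 2) *\<^sub>R partial_p e 1
      + (\<Sum>k=2..n-1. (\<phi> (q $ e (k-1) - q $ e k) - \<phi> (q $ e k - q $ e (k+1))) *\<^sub>R partial_p e k)
      + \<phi> (q $ e (n-1) - q $ e n) *\<^sub>R partial_p e n)"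

definition first_particle_force ::
    "(nat \<Rightarrow> 'n::finite) \<Rightarrow> (real^'n) \<times> (real^'n) \<Rightarrow> (real^'n) \<times> (real^'n)" where
  "first_particle_force e = (\<lambda>x. partial_p e 1)"

end

theory Submission
  imports Defs
begin

text \<open>Near a fixed point \<open>x\<close>, the values of the zero-time ideal do not change when it is enlarged to a
  module over the smooth functions on a neighbourhood \<open>U\<close> of \<open>x\<close>, and by the Leibniz rule this
  module is still closed under brackets with itself and with the drift \<open>f\<close>. It contains
  \<open>\<partial>/\<partial>p\<^sub>1\<close>. If it contains \<open>\<partial>/\<partial>p\<^sub>k\<close>, it contains \<open>[\<partial>/\<partial>p\<^sub>k, f] = \<partial>/\<partial>q\<^sub>k\<close>, and then
  \<open>[\<partial>/\<partial>q\<^sub>k, f]\<close>, which modulo the fields already found is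
  \<open>\<phi>'(q\<^sub>k - q\<^bsub>k+1\<^esub>) (\<partial>/\<partial>p\<^bsub>k+1\<^esub> - \<partial>/\<partial>p\<^sub>k)\<close>. The coefficient may vanish at \<open>x\<close>, but bracketing
  repeatedly with \<open>\<partial>/\<partial>q\<^sub>k\<close> replaces it by any higher derivative of \<open>\<phi>\<close>. These cannot all vanish at
  a point: otherwise \<open>\<Phi>\<close>, being analytic, would be affine, hence constant since it is bounded below,
  contradicting its growth. Dividing by a nonvanishing one gives \<open>\<partial>/\<partial>p\<^bsub>k+1\<^esub>\<close>.\<close>

section \<open>Real analytic functions\<close>

text \<open>Termwise differentiation inside the interval of convergence; \<open>\<Phi>\<close>
  coincides with the series near \<open>y\<close>, so the derivative transfers. The second part
  presents \<open>deriv \<Phi>\<close> as a power series with the same \<open>r\<close>, so the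
  lemma can be iterated.\<close>

lemma power_series_deriv:
  fixes \<Phi> :: "real \<Rightarrow> real"
  assumes s: "\<And>y. \<bar>y - x\<bar> < r \<Longrightarrow> (\<lambda>k. a k * (y - x) ^ k) sums \<Phi> y"
    and y: "\<bar>y - x\<bar> < r"
  shows "(\<Phi> has_real_derivative (\<Sum>k. diffs a k * (y - x) ^ k)) (at y)"
    and "(\<lambda>k. diffs a k * (y - x) ^ k) sums deriv \<Phi> y"
proof -
  have sm: "summable (\<lambda>k. a k * z ^ k)" if "norm z < r" for z :: real
    using s[of "z + x"] that by (auto simp: sums_iff)
  have "DERIV (\<lambda>z. \<Sum>k. a k * z ^ k) (y - x) :> (\<Sum>k. diffs a k * (y - x) ^ k)"
    by (rule termdiffs_strong'[OF sm]) (use y in auto)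
  moreover have "((\<lambda>y. y - x) has_real_derivative 1) (at y)"
    by (auto intro!: derivative_eq_intros)
  ultimately have D: "((\<lambda>y. \<Sum>k. a k * (y - x) ^ k) has_real_derivative
      (\<Sum>k. diffs a k * (y - x) ^ k) * 1) (at y)"
    by (rule DERIV_chain2)
  have "open {y. \<bar>y - x\<bar> < r}"
    by (intro open_Collect_less continuous_intros)
  then have ev: "eventually (\<lambda>y. (\<Sum>k. a k * (y - x) ^ k) = \<Phi> y) (nhds y)"
    using y s by (auto simp: eventually_nhds sums_iff)
  then show D': "(\<Phi> has_real_derivative (\<Sum>k. diffs a k * (y - x) ^ k)) (at y)"
    using D by (simp add: DERIV_cong_ev[OF refl ev refl])
  have "summable (\<lambda>k. diffs a k * (y - x) ^ k)"
    by (rule termdiff_converges[OF _ sm]) (use y in auto)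
  then show "(\<lambda>k. diffs a k * (y - x) ^ k) sums deriv \<Phi> y"
    using DERIV_imp_deriv[OF D'] by (simp add: summable_sums)
qed

text \<open>Each induction step passes from \<open>\<Phi>\<close> to \<open>deriv \<Phi>\<close> and
  from \<open>a\<close> to \<open>diffs a\<close>; the factor \<open>k + 1\<close> in
  \<open>diffs\<close> builds up the factorial.\<close>

lemma power_series_coeff:
  fixes \<Phi> :: "real \<Rightarrow> real"
  assumes "r > 0" "\<And>y. \<bar>y - x\<bar> < r \<Longrightarrow> (\<lambda>k. a k * (y - x) ^ k) sums \<Phi> y"
  shows "(deriv ^^ k) \<Phi> x = fact k * a k"
  using assms(2)
proof (induction k arbitrary: \<Phi> a)
  case 0
  then show ?case
    using assms(1) 0[of x] powser_sums_zero[of a] by (auto simp: sums_iff)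
next
  case (Suc k)
  have "(deriv ^^ k) (deriv \<Phi>) x = fact k * diffs a k"
    using Suc.prems by (intro Suc.IH power_series_deriv(2)) auto
  then show ?case
    by (simp add: funpow_swap1 diffs_def algebra_simps)
qed

lemma real_analytic_differentiable:
  assumes "real_analytic \<Phi>"
  shows "\<Phi> field_differentiable (at x)"
proof -
  obtain a r where "r > 0" "\<And>y. \<bar>y - x\<bar> < r \<Longrightarrow> (\<lambda>k. a k * (y - x) ^ k) sums \<Phi> y"
    using assms unfolding real_analytic_def by blast
  then show ?thesis
    using power_series_deriv(1)[of x r a \<Phi> x] by (auto simp: field_differentiable_def)
qed

lemma real_analytic_deriv:
  assumes "real_analytic \<Phi>"
  shows "real_analytic (deriv \<Phi>)"
  unfolding real_analytic_def
proof
  fix x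
  obtain a r where "r > 0" "\<And>y. \<bar>y - x\<bar> < r \<Longrightarrow> (\<lambda>k. a k * (y - x) ^ k) sums \<Phi> y"
    using assms unfolding real_analytic_def by blast
  then show "\<exists>a. \<exists>r>0. \<forall>y. \<bar>y - x\<bar> < r \<longrightarrow> (\<lambda>k. a k * (y - x) ^ k) sums deriv \<Phi> y"
    using power_series_deriv(2)[of x r a \<Phi>] by blast
qed

lemma real_analytic_higher_deriv:
  "real_analytic \<Phi> \<Longrightarrow> real_analytic ((deriv ^^ k) \<Phi>)"
  by (induction k) (auto intro: real_analytic_deriv)

lemma higher_deriv_zero_on_open:
  fixes \<Phi> :: "real \<Rightarrow> real"
  assumes "open S" "\<And>y. y \<in> S \<Longrightarrow> \<Phi> y = 0" "y \<in> S"
  shows "(deriv ^^ k) \<Phi> y = 0"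
  using assms(2,3)
proof (induction k arbitrary: \<Phi> y)
  case (Suc k)
  have "deriv \<Phi> z = 0" if "z \<in> S" for z
  proof -
    have "(\<Phi> has_real_derivative 0) (at z)"
      by (rule has_field_derivative_transform_within_open[of "\<lambda>_. 0" _ _ S])
        (use assms(1) that Suc.prems in auto)
    then show ?thesis
      by (rule DERIV_imp_deriv)
  qed
  then show ?case
    using Suc by (simp add: funpow_swap1)
qed simp

text \<open>Identity theorem by connectedness: the set of points where all derivatives vanish is
  closed by continuity, open because the local power series there has only zero coefficients, and
  contains \<open>x\<close>.\<close>

lemma real_analytic_flat_imp_zero:
  assumes "real_analytic \<psi>" "\<And>k. (deriv ^^ k) \<psi> x = 0"
  shows "\<psi> y = 0"
proof -
  define A where "A = (\<Inter>k. {y. (deriv ^^ k) \<psi> y = 0})"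
  have "continuous_on UNIV ((deriv ^^ k) \<psi>)" for k
    using real_analytic_differentiable[OF real_analytic_higher_deriv[OF assms(1)]]
    by (intro continuous_at_imp_continuous_on) (auto intro: field_differentiable_imp_continuous_at)
  then have "closed A"
    unfolding A_def by (intro closed_INT ballI closed_Collect_eq) auto
  moreover have "open A"
    unfolding open_dist
  proof
    fix z
    assume z: "z \<in> A"
    obtain a r where r: "r > 0" and s: "\<And>y. \<bar>y - z\<bar> < r \<Longrightarrow> (\<lambda>k. a k * (y - z) ^ k) sums \<psi> y"
      using assms(1) unfolding real_analytic_def by blast
    have "a k = 0" for k
      using power_series_coeff[OF r s, of k] z by (auto simp: A_def)
    then have "\<psi> y = 0" if "y \<in> ball z r" for y
      using s[of y] that by (simp add: dist_real_def sums_iff abs_minus_commute)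
    then have "(deriv ^^ k) \<psi> y = 0" if "y \<in> ball z r" for y k
      using that by (intro higher_deriv_zero_on_open[of "ball z r"]) auto
    then show "\<exists>e>0. \<forall>y. dist y z < e \<longrightarrow> y \<in> A"
      using r by (auto simp: A_def dist_commute)
  qed
  moreover have "x \<in> A"
    using assms(2) by (simp add: A_def)
  ultimately have "A = UNIV"
    using clopen[of A] by auto
  then have "y \<in> A"
    by simp
  then have "(deriv ^^ 0) \<psi> y = 0"
    unfolding A_def by blast
  then show ?thesis
    by simp
qed

text \<open>The order starts at one because bracket coefficients involve \<open>\<phi>'\<close> and
  its derivatives, never \<open>\<phi>\<close> itself. If all of them vanished at \<open>y\<close>,
  the identity theorem would make the second derivative of \<open>\<Phi>\<close> zero
  everywhere.\<close>

lemma potential_higher_deriv_nonzero: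
  assumes "real_analytic \<Phi>" "bdd_below (range \<Phi>)" "filterlim \<Phi> at_top at_top"
  shows "\<exists>j. (deriv ^^ Suc j) (deriv \<Phi>) y \<noteq> 0"
proof (rule ccontr)
  assume "\<not> ?thesis"
  then have "(deriv ^^ j) (deriv (deriv \<Phi>)) y = 0" for j
    by (simp add: funpow_swap1)
  then have 0: "deriv (deriv \<Phi>) z = 0" for z
    using real_analytic_flat_imp_zero real_analytic_deriv assms(1) by blast
  have "(deriv \<Phi> has_real_derivative 0) (at z)" for z
    using real_analytic_differentiable[OF real_analytic_deriv[OF assms(1)], of z] 0[of z]
    by (metis DERIV_deriv_iff_field_differentiable)
  then have c: "deriv \<Phi> z = deriv \<Phi> 0" for z
    using DERIV_isconst_all by blast
  define b where "b = deriv \<Phi> 0"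
  have "(\<Phi> has_real_derivative b) (at z)" for z
    using real_analytic_differentiable[OF assms(1), of z] c[of z]
    by (metis DERIV_deriv_iff_field_differentiable b_def)
  then have "((\<lambda>z. \<Phi> z - b * z) has_real_derivative 0) (at z)" for z
    by (auto intro!: derivative_eq_intros)
  then have "\<Phi> z - b * z = \<Phi> 0 - b * 0" for z
    using DERIV_isconst_all[of "\<lambda>z. \<Phi> z - b * z"] by blast
  then have aff: "\<Phi> z = \<Phi> 0 + b * z" for z
    by (metis add.commute diff_add_cancel mult_zero_right diff_zero)
  obtain m where m: "\<And>z. m \<le> \<Phi> z"
    using assms(2) by (auto simp: bdd_below_def)
  have "b = 0"
  proof (rule ccontr)
    assume "b \<noteq> 0"
    \<comment> \<open>At this point the affine function takes the value \<open>m - 1\<close>, which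
      is below its lower bound \<open>m\<close>.\<close>
    then show False
      using aff[of "(m - 1 - \<Phi> 0) / b"] m[of "(m - 1 - \<Phi> 0) / b"] by simp
  qed
  then have const: "\<Phi> z = \<Phi> 0" for z
    using aff[of z] by simp
  have "eventually (\<lambda>z. \<Phi> z \<ge> \<Phi> 0 + 1) at_top"
    using assms(3) by (simp add: filterlim_at_top)
  then obtain z where "\<Phi> z \<ge> \<Phi> 0 + 1"
    by (auto simp: eventually_at_top_linorder)
  then show False
    using const[of z] by simp
qed

section \<open>Smooth functions\<close>

text \<open>Derivatives in fixed directions have the same codomain as \<open>F\<close>, so the
  recursion stays at one type; the full derivative would take values in a space of linear
  maps.\<close>

primrec times_differentiable_on ::
    "nat \<Rightarrow> 'a::euclidean_space set \<Rightarrow> ('a \<Rightarrow> 'b::real_normed_vector) \<Rightarrow> bool" where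
  "times_differentiable_on 0 U F \<longleftrightarrow> True"
| "times_differentiable_on (Suc k) U F \<longleftrightarrow> (\<forall>y\<in>U. F differentiable (at y)) \<and>
     (\<forall>v. times_differentiable_on k U (\<lambda>y. frechet_derivative F (at y) v))"

definition smooth_on :: "'a::euclidean_space set \<Rightarrow> ('a \<Rightarrow> 'b::real_normed_vector) \<Rightarrow> bool" where
  "smooth_on U F \<longleftrightarrow> (\<forall>k. times_differentiable_on k U F)"

lemma times_differentiable_on_cong:
  assumes "open U" "times_differentiable_on k U F" "\<And>y. y \<in> U \<Longrightarrow> F y = G y"
  shows "times_differentiable_on k U G"
  using assms(2,3)
proof (induction k arbitrary: F G)
  case (Suc k)
  have D: "(G has_derivative frechet_derivative F (at y)) (at y)" if "y \<in> U" for y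
  proof (rule has_derivative_transform_within_open[OF _ assms(1) that])
    show "(F has_derivative frechet_derivative F (at y)) (at y)"
      using Suc.prems that by (auto simp: frechet_derivative_works)
  qed (use Suc.prems in auto)
  have eq: "frechet_derivative G (at y) = frechet_derivative F (at y)" if "y \<in> U" for y
    using frechet_derivative_at[OF D[OF that]] by simp
  have "times_differentiable_on k U (\<lambda>y. frechet_derivative G (at y) v)" for v
    by (rule Suc.IH[of "\<lambda>y. frechet_derivative F (at y) v"]) (use Suc.prems(1) eq in auto)
  then show ?case
    using D by (auto simp: differentiable_def)
qed simp

text \<open>Calculus rules deliver an explicit derivative; by uniqueness it equals
  \<open>frechet_derivative\<close> on \<open>U\<close> and may replace it in the recursion.\<close>

lemma times_differentiable_on_SucI:
  assumes "open U" "\<And>y. y \<in> U \<Longrightarrow> (F has_derivative F' y) (at y)"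
    "\<And>v. times_differentiable_on k U (\<lambda>y. F' y v)"
  shows "times_differentiable_on (Suc k) U F"
proof -
  have "times_differentiable_on k U (\<lambda>y. frechet_derivative F (at y) v)" for v
    by (rule times_differentiable_on_cong[OF assms(1) assms(3)[of v]])
      (use frechet_derivative_at[OF assms(2)] in auto)
  then show ?thesis
    using assms(2) by (auto simp: differentiable_def)
qed

lemma times_differentiable_on_SucD:
  assumes "times_differentiable_on (Suc k) U F"
  shows "\<And>y. y \<in> U \<Longrightarrow> (F has_derivative frechet_derivative F (at y)) (at y)"
    and "times_differentiable_on k U (\<lambda>y. frechet_derivative F (at y) v)"
  using assms by (auto simp: frechet_derivative_works)

lemma times_differentiable_on_Suc_imp:
  "times_differentiable_on (Suc k) U F \<Longrightarrow> times_differentiable_on k U F"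
proof (induction k arbitrary: F)
  case (Suc k)
  then show ?case
    by (metis times_differentiable_on.simps(2))
qed simp

lemma times_differentiable_on_subset:
  "times_differentiable_on k U F \<Longrightarrow> V \<subseteq> U \<Longrightarrow> times_differentiable_on k V F"
  by (induction k arbitrary: F) auto

lemma times_differentiable_on_const: "times_differentiable_on k U (\<lambda>_. c)"
  by (induction k arbitrary: c) auto

lemma times_differentiable_on_add:
  assumes "open U" "times_differentiable_on k U F" "times_differentiable_on k U G"
  shows "times_differentiable_on k U (\<lambda>y. F y + G y)"
  using assms(2,3)
proof (induction k arbitrary: F G)
  case (Suc k)
  note D = times_differentiable_on_SucD[OF Suc.prems(1)] times_differentiable_on_SucD[OF Suc.prems(2)]
  show ?case
    by (rule times_differentiable_on_SucI[OF assms(1) has_derivative_add[OF D(1,3)]])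
      (auto intro: Suc.IH D)
qed simp

text \<open>The derivative is a sum of two products, each with one factor differentiated, so the
  induction closes once the order of the other factor is lowered. A general bilinear map covers
  scalar multiples, real products and inner products at once.\<close>

lemma times_differentiable_on_bilinear:
  assumes "bounded_bilinear bl" "open U" "times_differentiable_on k U F" "times_differentiable_on k U G"
  shows "times_differentiable_on k U (\<lambda>y. bl (F y) (G y))"
  using assms(3,4)
proof (induction k arbitrary: F G)
  case (Suc k)
  note D = times_differentiable_on_SucD[OF Suc.prems(1)] times_differentiable_on_SucD[OF Suc.prems(2)]
  show ?case
    by (rule times_differentiable_on_SucI[OF assms(2) bounded_bilinear.FDERIV[OF assms(1) D(1,3)]])
      (auto intro!: times_differentiable_on_add[OF assms(2)] Suc.IH D
        Suc.prems[THEN times_differentiable_on_Suc_imp])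
qed simp

lemma times_differentiable_on_linear:
  assumes "bounded_linear L" "open U"
  shows "times_differentiable_on k U L"
proof (cases k)
  case (Suc m)
  then show ?thesis
    using times_differentiable_on_SucI[OF assms(2), of L "\<lambda>_. L" m]
      bounded_linear.has_derivative[OF assms(1) has_derivative_ident]
    by (auto intro: times_differentiable_on_const)
qed simp

text \<open>The derivative of \<open>1 / h\<close> is a product of factors \<open>1 / h\<close>,
  needed only to one order less, and a derivative of \<open>h\<close>.\<close>

lemma times_differentiable_on_inverse:
  fixes h :: "'a::euclidean_space \<Rightarrow> real"
  assumes "open U" "times_differentiable_on k U h" "\<And>y. y \<in> U \<Longrightarrow> h y \<noteq> 0"
  shows "times_differentiable_on k U (\<lambda>y. inverse (h y))"
  using assms(2)
proof (induction k)
  case (Suc k)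
  note D = times_differentiable_on_SucD[OF Suc.prems]
  have "times_differentiable_on k U (\<lambda>y. (- 1) * (inverse (h y) * frechet_derivative h (at y) v * inverse (h y)))" for v
    by (intro times_differentiable_on_bilinear[OF bounded_bilinear_mult assms(1)]
        times_differentiable_on_const Suc.IH D
        Suc.prems[THEN times_differentiable_on_Suc_imp])
  then show ?case
    by (intro times_differentiable_on_SucI[OF assms(1) Deriv.has_derivative_inverse[OF assms(3) D(1)]]) auto
qed simp

text \<open>Differentiating in direction \<open>v\<close> gives the next derivative of
  \<open>\<phi>\<close> times the constant \<open>L v\<close>, hence the induction over all
  \<open>j\<close> simultaneously.\<close>

lemma times_differentiable_on_compose_linear:
  assumes "\<And>j y. (deriv ^^ j) \<phi> field_differentiable (at y)" "bounded_linear L" "open U"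
  shows "times_differentiable_on k U (\<lambda>y. (deriv ^^ j) \<phi> (L y :: real) :: real)"
proof (induction k arbitrary: j)
  case (Suc k)
  have "((deriv ^^ j) \<phi> has_derivative (\<lambda>v. (deriv ^^ Suc j) \<phi> z * v)) (at z)" for z
    using assms(1)[of j z] by (simp add: DERIV_deriv_iff_field_differentiable flip: has_field_derivative_def)
  note D = has_derivative_compose[OF bounded_linear.has_derivative[OF assms(2) has_derivative_ident] this]
  show ?case
    by (rule times_differentiable_on_SucI[OF assms(3) D])
      (intro times_differentiable_on_bilinear[OF bounded_bilinear_mult assms(3)] Suc.IH
        times_differentiable_on_const)
qed simp

lemma smooth_on_cong:
  "open U \<Longrightarrow> smooth_on U F \<Longrightarrow> (\<And>y. y \<in> U \<Longrightarrow> F y = G y) \<Longrightarrow> smooth_on U G"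
  unfolding smooth_on_def by (metis times_differentiable_on_cong)

lemma smooth_on_subset: "smooth_on U F \<Longrightarrow> V \<subseteq> U \<Longrightarrow> smooth_on V F"
  unfolding smooth_on_def by (metis times_differentiable_on_subset)

lemma smooth_on_has_derivative:
  "smooth_on U F \<Longrightarrow> y \<in> U \<Longrightarrow> (F has_derivative frechet_derivative F (at y)) (at y)"
  unfolding smooth_on_def by (metis times_differentiable_on_SucD(1))

lemma smooth_on_const: "smooth_on U (\<lambda>_. c)"
  by (simp add: smooth_on_def times_differentiable_on_const)

lemma smooth_on_add:
  "open U \<Longrightarrow> smooth_on U F \<Longrightarrow> smooth_on U G \<Longrightarrow> smooth_on U (\<lambda>y. F y + G y)"
  by (simp add: smooth_on_def times_differentiable_on_add)

lemma smooth_on_scaleR: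
  "open U \<Longrightarrow> smooth_on U h \<Longrightarrow> smooth_on U F \<Longrightarrow> smooth_on U (\<lambda>y. h y *\<^sub>R F y)"
  by (simp add: smooth_on_def times_differentiable_on_bilinear[OF bounded_bilinear_scaleR])

lemma smooth_on_diff:
  "open U \<Longrightarrow> smooth_on U F \<Longrightarrow> smooth_on U G \<Longrightarrow> smooth_on U (\<lambda>y. F y - G y)"
  using smooth_on_add[of U F "\<lambda>y. (- 1) *\<^sub>R G y"] smooth_on_scaleR[of U "\<lambda>_. - 1" G]
  by (simp add: smooth_on_const)

lemma smooth_on_sum:
  "open U \<Longrightarrow> (\<And>i. i \<in> A \<Longrightarrow> smooth_on U (F i)) \<Longrightarrow> smooth_on U (\<lambda>y. \<Sum>i\<in>A. F i y)"
  by (induction A rule: infinite_finite_induct) (auto intro: smooth_on_add smooth_on_const)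

lemma smooth_on_inverse:
  fixes h :: "'a::euclidean_space \<Rightarrow> real"
  shows "open U \<Longrightarrow> smooth_on U h \<Longrightarrow> (\<And>y. y \<in> U \<Longrightarrow> h y \<noteq> 0) \<Longrightarrow> smooth_on U (\<lambda>y. inverse (h y))"
  by (simp add: smooth_on_def times_differentiable_on_inverse)

lemma smooth_on_linear: "bounded_linear L \<Longrightarrow> open U \<Longrightarrow> smooth_on U L"
  by (simp add: smooth_on_def times_differentiable_on_linear)

text \<open>Smoothness only speaks about fixed directions, so the varying direction
  \<open>V y\<close> is expanded in the standard basis, with smooth coefficients.\<close>

lemma smooth_on_directional_derivative:
  assumes "open U" "smooth_on U F" "smooth_on U (V :: 'a::euclidean_space \<Rightarrow> 'a)"
  shows "smooth_on U (\<lambda>y. frechet_derivative F (at y) (V y))"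
proof (rule smooth_on_cong[OF assms(1)])
  have "smooth_on U (\<lambda>y. V y \<bullet> b)" for b
    using assms(3) unfolding smooth_on_def
    by (auto intro!: times_differentiable_on_bilinear[OF bounded_bilinear_inner assms(1)]
        times_differentiable_on_const)
  moreover have "smooth_on U (\<lambda>y. frechet_derivative F (at y) b)" for b
    using assms(2) unfolding smooth_on_def by (metis times_differentiable_on_SucD(2))
  ultimately show "smooth_on U (\<lambda>y. \<Sum>b\<in>Basis. (V y \<bullet> b) *\<^sub>R frechet_derivative F (at y) b)"
    by (intro smooth_on_sum smooth_on_scaleR assms(1)) auto
next
  fix y
  assume "y \<in> U"
  then interpret bounded_linear "frechet_derivative F (at y)"
    using smooth_on_has_derivative[OF assms(2)] has_derivative_bounded_linear by blast
  show "(\<Sum>b\<in>Basis. (V y \<bullet> b) *\<^sub>R frechet_derivative F (at y) b) = frechet_derivative F (at y) (V y)"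
    by (simp flip: scaleR sum add: euclidean_representation)
qed

section \<open>Lie brackets\<close>

lemma lie_bracket_eq:
  assumes "(F has_derivative F') (at y)" "(G has_derivative G') (at y)"
  shows "lie_bracket F G y = G' (F y) - F' (G y)"
  using frechet_derivative_at[OF assms(1)] frechet_derivative_at[OF assms(2)]
  by (simp add: lie_bracket_def)

lemma lie_bracket_antisym: "lie_bracket F G y = - lie_bracket G F y"
  by (simp add: lie_bracket_def)

lemma smooth_on_lie_bracket:
  "open U \<Longrightarrow> smooth_on U F \<Longrightarrow> smooth_on U G \<Longrightarrow> smooth_on U (lie_bracket F G)"
  unfolding lie_bracket_def by (intro smooth_on_diff smooth_on_directional_derivative)

lemma lie_algebra_generated_smooth:
  assumes "F \<in> lie_algebra_generated S" "\<And>G. G \<in> S \<Longrightarrow> smooth_on UNIV G"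
  shows "smooth_on UNIV F"
  using assms
  by induction (auto intro: smooth_on_const smooth_on_add smooth_on_scaleR smooth_on_lie_bracket)

text \<open>Makes the fields of the ideal smooth and admissible on the left of a bracket, so that
  the ideal is closed under brackets with itself.\<close>

lemma lie_ideal_generated_subset:
  assumes "F \<in> lie_ideal_generated (lie_algebra_generated S) T" "T \<subseteq> S"
  shows "F \<in> lie_algebra_generated S"
  using assms by induction (auto intro: lie_algebra_generated.intros)

lemma subspace_lie_ideal_generated_values: "subspace {F x |F. F \<in> lie_ideal_generated L S}"
  unfolding subspace_def
proof (intro conjI ballI allI)
  show "0 \<in> {F x |F. F \<in> lie_ideal_generated L S}"
    using lie_ideal_generated.zero[of L S] by fastforce
next
  fix u v assume "u \<in> {F x |F. F \<in> lie_ideal_generated L S}" "v \<in> {F x |F. F \<in> lie_ideal_generated L S}"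
  then obtain F G where "F \<in> lie_ideal_generated L S" "G \<in> lie_ideal_generated L S" "u = F x" "v = G x"
    by blast
  then show "u + v \<in> {F x |F. F \<in> lie_ideal_generated L S}"
    using lie_ideal_generated.add[of F L S G] by force
next
  fix c u assume "u \<in> {F x |F. F \<in> lie_ideal_generated L S}"
  then obtain F where "F \<in> lie_ideal_generated L S" "u = F x"
    by blast
  then show "c *\<^sub>R u \<in> {F x |F. F \<in> lie_ideal_generated L S}"
    using lie_ideal_generated.scale[of F L S c] by force
qed

text \<open>Function coefficients permit division by a function without zeros on \<open>U\<close>.
  The rule \<open>cong\<close> disregards values outside \<open>U\<close>, so a field stands for its
  restriction to \<open>U\<close>.\<close>

inductive_set smooth_module ::
    "'a::euclidean_space set \<Rightarrow> ('a \<Rightarrow> 'a) set \<Rightarrow> ('a \<Rightarrow> 'a) set"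
  for U :: "'a set" and I :: "('a \<Rightarrow> 'a) set" where
  generator: "F \<in> I \<Longrightarrow> F \<in> smooth_module U I"
| add: "F \<in> smooth_module U I \<Longrightarrow> G \<in> smooth_module U I \<Longrightarrow> (\<lambda>x. F x + G x) \<in> smooth_module U I"
| scale: "smooth_on U h \<Longrightarrow> F \<in> smooth_module U I \<Longrightarrow> (\<lambda>x. h x *\<^sub>R F x) \<in> smooth_module U I"
| cong: "F \<in> smooth_module U I \<Longrightarrow> (\<And>y. y \<in> U \<Longrightarrow> F y = G y) \<Longrightarrow> G \<in> smooth_module U I"

lemma smooth_module_uminus:
  "F \<in> smooth_module U I \<Longrightarrow> (\<lambda>y. - F y) \<in> smooth_module U I"
  using smooth_module.scale[OF smooth_on_const[of U "- 1"], of F I] by simp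

lemma smooth_module_smooth:
  assumes "F \<in> smooth_module U I" "open U" "\<And>F. F \<in> I \<Longrightarrow> smooth_on U F"
  shows "smooth_on U F"
  using assms by induction (auto intro: smooth_on_add smooth_on_scaleR smooth_on_cong)

text \<open>At the single point \<open>x\<close> a coefficient function is just a number, so passing
  to the module creates no new values.\<close>

lemma smooth_module_value:
  assumes "F \<in> smooth_module U I" "x \<in> U" "subspace {F x |F. F \<in> I}"
  shows "F x \<in> {F x |F. F \<in> I}"
  using assms(1)
proof induction
  case (add F G)
  then show ?case using subspace_add[OF assms(3)] by blast
next
  case (scale h F)
  then show ?case using subspace_scale[OF assms(3)] by blast
next
  case (cong F G)
  then show ?case using assms(2) by simp
qed blast

text \<open>Leibniz rule: \<open>[G, h F] = h [G, F] + (G h) F\<close>, where \<open>G h\<close> is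
  the derivative of \<open>h\<close> along \<open>G\<close>. Hence control of the brackets with
  generators suffices.\<close>

lemma smooth_module_bracket_left:
  assumes "open U" "\<And>F. F \<in> I \<Longrightarrow> smooth_on U F" "smooth_on U G"
    "\<And>F. F \<in> I \<Longrightarrow> lie_bracket G F \<in> smooth_module U I"
    "F \<in> smooth_module U I"
  shows "lie_bracket G F \<in> smooth_module U I"
  using assms(5)
proof induction
  case (generator F)
  then show ?case by (rule assms(4))
next
  case (add F H)
  show ?case
  proof (rule smooth_module.cong[OF smooth_module.add[OF add.IH]])
    fix y assume y: "y \<in> U"
    note D = smooth_on_has_derivative[OF smooth_module_smooth[OF _ assms(1,2)] y]
    note DG = smooth_on_has_derivative[OF assms(3) y]
    have "bounded_linear (frechet_derivative G (at y))"
      using DG has_derivative_bounded_linear by blast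
    then show "lie_bracket G F y + lie_bracket G H y = lie_bracket G (\<lambda>x. F x + H x) y"
      using lie_bracket_eq[OF DG D[OF add.hyps(1)]] lie_bracket_eq[OF DG D[OF add.hyps(2)]]
        lie_bracket_eq[OF DG has_derivative_add[OF D[OF add.hyps(1)] D[OF add.hyps(2)]]]
      by (simp add: bounded_linear.linear linear_add)
  qed
next
  case (scale h F)
  have "smooth_on U (\<lambda>y. frechet_derivative h (at y) (G y))"
    by (intro smooth_on_directional_derivative assms scale)
  note smooth_module.add[OF smooth_module.scale[OF scale.hyps(1) scale.IH]
      smooth_module.scale[OF this scale.hyps(2)]]
  then show ?case
  proof (rule smooth_module.cong)
    fix y assume y: "y \<in> U"
    note D = smooth_on_has_derivative[OF smooth_module_smooth[OF scale.hyps(2) assms(1,2)] y]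
    note DG = smooth_on_has_derivative[OF assms(3) y]
    note Dh = smooth_on_has_derivative[OF scale.hyps(1) y]
    have "bounded_linear (frechet_derivative G (at y))"
      using DG has_derivative_bounded_linear by blast
    then show "h y *\<^sub>R lie_bracket G F y + frechet_derivative h (at y) (G y) *\<^sub>R F y
        = lie_bracket G (\<lambda>x. h x *\<^sub>R F x) y"
      by (simp add: lie_bracket_eq[OF DG D] lie_bracket_eq[OF DG has_derivative_scaleR[OF Dh D]]
          bounded_linear.linear linear_scale scaleR_right_diff_distrib)
  qed
next
  case (cong F H)
  show ?case
  proof (rule smooth_module.cong[OF cong.IH])
    fix y assume y: "y \<in> U"
    note D = smooth_on_has_derivative[OF smooth_module_smooth[OF cong.hyps(1) assms(1,2)] y]
    note DG = smooth_on_has_derivative[OF assms(3) y]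
    have "(H has_derivative frechet_derivative F (at y)) (at y)"
      using has_derivative_transform_within_open[OF D assms(1) y] cong.hyps(2) by blast
    then show "lie_bracket G F y = lie_bracket G H y"
      by (simp add: lie_bracket_eq[OF DG D] lie_bracket_eq[OF DG] cong.hyps(2)[OF y])
  qed
qed

text \<open>The previous lemma is used twice: first with a generator on the left, then, after
  swapping by antisymmetry, with the module element \<open>F\<close> on the left.\<close>

lemma smooth_module_bracket:
  assumes "open U" "\<And>F. F \<in> I \<Longrightarrow> smooth_on U F"
    "\<And>F G. F \<in> I \<Longrightarrow> G \<in> I \<Longrightarrow> lie_bracket F G \<in> I"
    "F \<in> smooth_module U I" "G \<in> smooth_module U I"
  shows "lie_bracket F G \<in> smooth_module U I"
proof (rule smooth_module_bracket_left[OF assms(1,2) _ _ assms(5)])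
  show "smooth_on U F"
    using smooth_module_smooth[OF assms(4,1,2)] .
  fix H assume H: "H \<in> I"
  then have "lie_bracket H F \<in> smooth_module U I"
    by (intro smooth_module_bracket_left[OF assms(1,2) _ _ assms(4)] smooth_module.generator assms)
  then show "lie_bracket F H \<in> smooth_module U I"
    by (rule smooth_module_uminus[THEN smooth_module.cong]) (simp add: lie_bracket_antisym[of F H])
qed

section \<open>The forced chain\<close>

definition gap :: "(nat \<Rightarrow> 'n::finite) \<Rightarrow> nat \<Rightarrow> (real^'n) \<times> (real^'n) \<Rightarrow> real" where
  "gap e k x = fst x $ e k - fst x $ e (Suc k)"

lemma bounded_linear_gap: "bounded_linear (gap e k)"
  unfolding gap_def
  by (rule bounded_linear_sub; rule bounded_linear_compose[OF bounded_linear_vec_nth bounded_linear_fst])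

lemma bounded_linear_momentum: "bounded_linear (\<lambda>x :: 'a::real_normed_vector \<times> (real^'n). snd x $ i)"
  by (rule bounded_linear_compose[OF bounded_linear_vec_nth bounded_linear_snd])

lemma sum_by_parts_chain:
  fixes c :: "nat \<Rightarrow> real" and P :: "nat \<Rightarrow> 'v::real_vector"
  assumes "n \<ge> 2"
  shows "(\<Sum>k=2..n-1. (c (k-1) - c k) *\<^sub>R P k) + c (n-1) *\<^sub>R P n - c 1 *\<^sub>R P 1
    = (\<Sum>k=1..<n. c k *\<^sub>R (P (Suc k) - P k))"
proof -
  \<comment> \<open>Writing \<open>n = m + 2\<close> removes the subtraction from the bounds and
    allows induction starting from two particles.\<close>
  have "(\<Sum>k=2..Suc m. (c (k-1) - c k) *\<^sub>R P k) + c (Suc m) *\<^sub>R P (Suc (Suc m)) - c 1 *\<^sub>R P 1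
      = (\<Sum>k=1..<Suc (Suc m). c k *\<^sub>R (P (Suc k) - P k))" for m
    by (induction m) (simp_all add: algebra_simps)
  from this[of "n - 2"] show ?thesis
    using assms by (simp add: Suc_diff_Suc numeral_2_eq_2)
qed

text \<open>Regroups the forces by gaps instead of particles: the interaction across gap
  \<open>k\<close> acts on particles \<open>k\<close> and \<open>k + 1\<close> with opposite signs,
  so each gap contributes one term.\<close>

lemma chain_drift_eq:
  assumes "n \<ge> 2"
  shows "chain_drift n e \<phi> = (\<lambda>x. (\<Sum>k=1..n. (snd x $ e k) *\<^sub>R partial_q e k)
    + (\<Sum>k=1..<n. \<phi> (gap e k x) *\<^sub>R (partial_p e (Suc k) - partial_p e k)))"
proof
  fix x
  have eq: "(\<Sum>k=2..n-1. (\<phi> (fst x $ e (k-1) - fst x $ e k) - \<phi> (gap e k x)) *\<^sub>R partial_p e k)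
      = (\<Sum>k=2..n-1. (\<phi> (gap e (k-1) x) - \<phi> (gap e k x)) *\<^sub>R partial_p e k)"
    by (intro sum.cong) (auto simp: gap_def)
  have gaps: "fst x $ e 1 - fst x $ e 2 = gap e 1 x" "fst x $ e (n-1) - fst x $ e n = gap e (n-1) x"
    "fst x $ e k - fst x $ e (k+1) = gap e k x" for k
    using assms by (auto simp: gap_def numeral_2_eq_2)
  show "chain_drift n e \<phi> x = (\<Sum>k=1..n. (snd x $ e k) *\<^sub>R partial_q e k)
    + (\<Sum>k=1..<n. \<phi> (gap e k x) *\<^sub>R (partial_p e (Suc k) - partial_p e k))"
    unfolding sum_by_parts_chain[OF assms, of "\<lambda>k. \<phi> (gap e k x)" "partial_p e", symmetric]
    unfolding chain_drift_def case_prod_beta gaps eq by simp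
qed

text \<open>\<open>j k\<close> records which derivative of \<open>\<phi>\<close> stays away from
  zero on \<open>U\<close> along gap \<open>k\<close>; different gaps may call for different
  orders.\<close>

locale nondegenerate_chain =
  fixes n :: nat and e :: "nat \<Rightarrow> 'n::finite" and \<phi> :: "real \<Rightarrow> real"
    and U :: "((real^'n) \<times> (real^'n)) set" and j :: "nat \<Rightarrow> nat"
  assumes n: "n \<ge> 2"
    and e: "bij_betw e {1..n} UNIV"
    and \<phi>: "(deriv ^^ i) \<phi> field_differentiable (at r)"
    and U: "open U"
    and nonzero: "k \<in> {1..<n} \<Longrightarrow> y \<in> U \<Longrightarrow> (deriv ^^ Suc (j k)) \<phi> (gap e k y) \<noteq> 0"
begin

abbreviation "f \<equiv> chain_drift n e \<phi>"
abbreviation "g \<equiv> first_particle_force e"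
abbreviation "I \<equiv> zero_time_ideal f g"
abbreviation "J \<equiv> smooth_module U I"

lemma e_eq_iff: "i \<in> {1..n} \<Longrightarrow> k \<in> {1..n} \<Longrightarrow> e i = e k \<longleftrightarrow> i = k"
  by (rule inj_on_eq_iff[OF bij_betw_imp_inj_on[OF e]])

lemma force_derivative_has_derivative:
  "((\<lambda>x. (deriv ^^ i) \<phi> (gap e k x)) has_derivative
     (\<lambda>v. (deriv ^^ Suc i) \<phi> (gap e k x) * gap e k v)) (at x)"
proof -
  have "((deriv ^^ i) \<phi> has_derivative (\<lambda>v. (deriv ^^ Suc i) \<phi> r * v)) (at r)" for r
    using \<phi>[of i r] by (simp add: DERIV_deriv_iff_field_differentiable flip: has_field_derivative_def)
  then show ?thesis
    by (rule has_derivative_compose[OF bounded_linear_imp_has_derivative[OF bounded_linear_gap]])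
qed

lemma drift_has_derivative:
  "(f has_derivative (\<lambda>v. (\<Sum>k=1..n. (snd v $ e k) *\<^sub>R partial_q e k)
    + (\<Sum>k=1..<n. (deriv \<phi> (gap e k x) * gap e k v) *\<^sub>R (partial_p e (Suc k) - partial_p e k)))) (at x)"
  unfolding chain_drift_eq[OF n]
  by (rule has_derivative_add[OF has_derivative_sum has_derivative_sum];
      rule has_derivative_scaleR_left)
    (rule bounded_linear_imp_has_derivative[OF bounded_linear_momentum],
      rule force_derivative_has_derivative[of 0, simplified])

lemma smooth_on_force: "open V \<Longrightarrow> smooth_on V (\<lambda>x. (deriv ^^ i) \<phi> (gap e k x))"
  unfolding smooth_on_def
  by (intro allI, rule times_differentiable_on_compose_linear[OF \<phi> bounded_linear_gap])

lemma smooth_on_drift: "smooth_on UNIV f"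
  unfolding chain_drift_eq[OF n]
proof (rule smooth_on_add[OF open_UNIV smooth_on_sum[OF open_UNIV] smooth_on_sum[OF open_UNIV]])
  show "smooth_on UNIV (\<lambda>x. (snd x $ e k) *\<^sub>R partial_q e k)" for k
    by (rule smooth_on_scaleR[OF open_UNIV
          smooth_on_linear[OF bounded_linear_momentum open_UNIV] smooth_on_const])
  show "smooth_on UNIV (\<lambda>x. \<phi> (gap e k x) *\<^sub>R (partial_p e (Suc k) - partial_p e k))" for k
    by (rule smooth_on_scaleR[OF open_UNIV
          smooth_on_force[OF open_UNIV, of 0, simplified] smooth_on_const])
qed

lemma smooth_on_algebra: "F \<in> lie_algebra_generated {f, g} \<Longrightarrow> smooth_on U F"
  by (rule smooth_on_subset[OF lie_algebra_generated_smooth[of _ "{f, g}"]])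
    (auto simp: smooth_on_drift first_particle_force_def smooth_on_const)

lemma ideal_subset_algebra: "F \<in> I \<Longrightarrow> F \<in> lie_algebra_generated {f, g}"
  unfolding zero_time_ideal_def by (rule lie_ideal_generated_subset) auto

lemma bracket_ideal: "F \<in> lie_algebra_generated {f, g} \<Longrightarrow> G \<in> I \<Longrightarrow> lie_bracket F G \<in> I"
  unfolding zero_time_ideal_def by (rule lie_ideal_generated.bracket)

lemma bracket_module: "F \<in> J \<Longrightarrow> G \<in> J \<Longrightarrow> lie_bracket F G \<in> J"
  by (rule smooth_module_bracket[OF U])
    (auto intro: smooth_on_algebra ideal_subset_algebra bracket_ideal)

lemma bracket_module_drift:
  assumes "F \<in> J"
  shows "lie_bracket F f \<in> J"
proof -
  have f: "f \<in> lie_algebra_generated {f, g}"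
    by (auto intro: lie_algebra_generated.generator)
  have "lie_bracket f F \<in> J"
    by (rule smooth_module_bracket_left[OF U _ _ _ assms])
      (auto intro: smooth_on_algebra ideal_subset_algebra f smooth_module.generator bracket_ideal)
  then show ?thesis
    by (rule smooth_module_uminus[THEN smooth_module.cong]) (simp add: lie_bracket_antisym[of F f])
qed

section \<open>Propagation along the chain\<close>

lemma lie_bracket_const_drift:
  "lie_bracket (\<lambda>_. v) f x = (\<Sum>k=1..n. (snd v $ e k) *\<^sub>R partial_q e k)
    + (\<Sum>k=1..<n. (deriv \<phi> (gap e k x) * gap e k v) *\<^sub>R (partial_p e (Suc k) - partial_p e k))"
  by (simp add: lie_bracket_eq[OF has_derivative_const drift_has_derivative])

text \<open>The momentum of particle \<open>k\<close> enters the drift only as the coefficient of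
  \<open>partial_q e k\<close>, so bracketing with the drift isolates that field.\<close>

lemma partial_q_in_module:
  assumes "k \<in> {1..n}" "(\<lambda>_. partial_p e k) \<in> J"
  shows "(\<lambda>_. partial_q e k) \<in> J"
proof (rule smooth_module.cong[OF bracket_module_drift[OF assms(2)]])
  fix y
  have "(\<Sum>i=1..n. (snd (partial_p e k) $ e i) *\<^sub>R partial_q e i) =
      (\<Sum>i=1..n. if i = k then partial_q e i else 0)"
    using assms(1) by (intro sum.cong) (auto simp: partial_p_def axis_def e_eq_iff)
  also have "\<dots> = partial_q e k"
    using assms(1) by simp
  finally have "(\<Sum>i=1..n. (snd (partial_p e k) $ e i) *\<^sub>R partial_q e i) = partial_q e k" .
  moreover have "gap e i (partial_p e k) = 0" for i
    by (simp add: gap_def partial_p_def)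
  ultimately show "lie_bracket (\<lambda>_. partial_p e k) f y = partial_q e k"
    unfolding lie_bracket_const_drift by simp
qed

text \<open>The position of particle \<open>k\<close> enters gap \<open>k\<close> and, for
  \<open>k > 1\<close>, gap \<open>k - 1\<close>. The bracket with the drift therefore has up to two
  terms, and \<open>prev\<close> serves to cancel the second. Further brackets raise the order of
  the coefficient until it is invertible on \<open>U\<close>.\<close>

lemma partial_p_diff_in_module:
  assumes k: "k \<in> {1..<n}" and q: "(\<lambda>_. partial_q e k) \<in> J"
    and prev: "k > 1 \<Longrightarrow> (\<lambda>_. partial_p e k - partial_p e (k - 1)) \<in> J"
  shows "(\<lambda>_. partial_p e (Suc k) - partial_p e k) \<in> J"
proof -
  \<comment> \<open>For \<open>l = k\<close>, \<open>i\<close> counts the brackets with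
    \<open>partial_q e k\<close> taken after the one with the drift.\<close>
  define S where "S i l x = (deriv ^^ Suc i) \<phi> (gap e l x) *\<^sub>R (partial_p e (Suc l) - partial_p e l)"
    for i l x
  have gap_q: "gap e l (partial_q e k) = (if l = k then 1 else 0) - (if Suc l = k then 1 else 0)"
    if "l \<in> {1..<n}" for l
    using that k by (simp add: gap_def partial_q_def axis_def e_eq_iff)
  have br: "lie_bracket (\<lambda>_. partial_q e k) f x = S 0 k x - (if k > 1 then S 0 (k - 1) x else 0)" for x
  proof -
    have "lie_bracket (\<lambda>_. partial_q e k) f x
        = (\<Sum>l=1..<n. (if l = k then S 0 l x else 0) - (if l = k - 1 then S 0 l x else 0))"
      unfolding lie_bracket_const_drift
      by (auto simp: S_def gap_q partial_q_def[THEN arg_cong[of _ _ snd]] intro!: sum.cong)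
    \<comment> \<open>For \<open>k = 1\<close> the index \<open>k - 1 = 0\<close> lies outside the
      summation range, so only the first term survives.\<close>
    also have "\<dots> = S 0 k x - (if k > 1 then S 0 (k - 1) x else 0)"
      using k by (auto simp: sum_subtractf)
    finally show ?thesis .
  qed
  have S: "S i k \<in> J" for i
  proof (induction i)
    case 0
    have *: "(\<lambda>x. lie_bracket (\<lambda>_. partial_q e k) f x) \<in> J"
      by (rule bracket_module_drift[OF q])
    show ?case
    proof (cases "k > 1")
      case True
      \<comment> \<open>The unwanted term is a smooth multiple of the field in \<open>prev\<close>,
        so it can be added back within the module.\<close>
      then have "S 0 (k - 1) \<in> J"
        using smooth_module.scale[OF smooth_on_force[OF U, of 1 "k - 1"] prev[OF True]]
        by (simp add: S_def[abs_def])
      from smooth_module.add[OF * this] show ?thesis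
        by (rule smooth_module.cong) (use True in \<open>simp add: br\<close>)
    next
      case False
      from * show ?thesis
        by (rule smooth_module.cong) (use False in \<open>simp add: br\<close>)
    qed
  next
    case (Suc i)
    show ?case
    \<comment> \<open>Along \<open>partial_q e k\<close> the gap \<open>k\<close> grows with slope 1
      and the direction of \<open>S i k\<close> is constant, so the bracket merely differentiates
      the coefficient.\<close>
    proof (rule smooth_module.cong[OF bracket_module[OF q Suc]])
      fix x
      have "(S i k has_derivative (\<lambda>v. ((deriv ^^ Suc (Suc i)) \<phi> (gap e k x) * gap e k v) *\<^sub>R
          (partial_p e (Suc k) - partial_p e k))) (at x)"
        unfolding S_def[abs_def]
        by (intro has_derivative_scaleR_left force_derivative_has_derivative)
      from lie_bracket_eq[OF has_derivative_const this]
      show "lie_bracket (\<lambda>_. partial_q e k) (S i k) x = S (Suc i) k x"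
        using k by (simp add: gap_q S_def)
    qed
  qed
  \<comment> \<open>The chosen coefficient has no zero on \<open>U\<close>, so its inverse is an
    admissible module coefficient and can be divided out.\<close>
  have "smooth_on U (\<lambda>x. inverse ((deriv ^^ Suc (j k)) \<phi> (gap e k x)))"
    by (rule smooth_on_inverse[OF U smooth_on_force[OF U] nonzero[OF k]])
  from smooth_module.scale[OF this S[of "j k"]] show ?thesis
  proof (rule smooth_module.cong)
    fix y
    assume "y \<in> U"
    from nonzero[OF k this]
    show "inverse ((deriv ^^ Suc (j k)) \<phi> (gap e k y)) *\<^sub>R S (j k) k y
        = partial_p e (Suc k) - partial_p e k"
      unfolding S_def by (simp del: funpow.simps)
  qed
qed

text \<open>Starts at the forced particle. The induction is complete induction because reaching
  particle \<open>m + 1\<close> uses the fields of both \<open>m\<close> and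
  \<open>m - 1\<close>.\<close>

lemma partial_p_in_module: "k \<in> {1..n} \<Longrightarrow> (\<lambda>_. partial_p e k) \<in> J"
proof (induction k rule: less_induct)
  case (less k)
  show ?case
  proof (cases "k = 1")
    case True
    have "g \<in> I"
      by (simp add: zero_time_ideal_def lie_ideal_generated.generator)
    then show ?thesis
      using True by (auto simp: first_particle_force_def intro: smooth_module.generator)
  next
    case False
    then obtain m where m: "k = Suc m" "m \<in> {1..<n}"
      using less.prems by (cases k) auto
    then have p: "(\<lambda>_. partial_p e m) \<in> J"
      by (auto intro: less.IH)
    have "(\<lambda>_. partial_p e (Suc m) - partial_p e m) \<in> J"
    proof (rule partial_p_diff_in_module[OF m(2)])
      show "(\<lambda>_. partial_q e m) \<in> J"
        using m(2) by (auto intro: partial_q_in_module p)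
      assume "m > 1"
      then have "(\<lambda>_. partial_p e (m - 1)) \<in> J"
        using m by (intro less.IH) auto
      from smooth_module.add[OF p smooth_module_uminus[OF this]]
      show "(\<lambda>_. partial_p e m - partial_p e (m - 1)) \<in> J"
        by simp
    qed
    from smooth_module.add[OF this p] show ?thesis
      by (simp add: m(1))
  qed
qed

text \<open>All standard basis vectors, as constant fields, lie in the module, hence are values of
  the ideal at \<open>x\<close>, and these values form a subspace.\<close>

lemma ideal_values_eq_UNIV:
  assumes "x \<in> U"
  shows "{F x |F. F \<in> I} = UNIV"
proof -
  have sub: "subspace {F x |F. F \<in> I}"
    unfolding zero_time_ideal_def by (rule subspace_lie_ideal_generated_values)
  have "b \<in> {F x |F. F \<in> I}" if "b \<in> Basis" for b
  proof -
    have "\<exists>i. b = (axis i 1, 0) \<or> b = (0, axis i 1)"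
      using that by (auto simp: Basis_prod_def Basis_vec_def)
    then obtain i where i: "b = (axis i 1, 0) \<or> b = (0, axis i 1)" ..
    have "i \<in> e ` {1..n}"
      using e by (simp add: bij_betw_def)
    then obtain k where k: "k \<in> {1..n}" "i = e k"
      by blast
    then have "b = partial_q e k \<or> b = partial_p e k"
      using i by (simp add: partial_q_def partial_p_def)
    then have "(\<lambda>_. b) \<in> J"
      using partial_p_in_module[OF k(1)] partial_q_in_module[OF k(1)] by auto
    then show ?thesis
      by (rule smooth_module_value[OF _ assms sub])
  qed
  then have "span Basis \<subseteq> {F x |F. F \<in> I}"
    by (intro span_minimal sub) auto
  then show ?thesis
    by auto
qed

end

section \<open>Choice of the neighbourhood and dimension count\<close>

theorem proposition2p1:
  fixes n :: nat and e :: "nat \<Rightarrow> 'n::finite" and \<Phi> :: "real \<Rightarrow> real"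
    and x :: "(real^'n) \<times> (real^'n)"
  assumes "n \<ge> 2"
    and "bij_betw e {1..n} UNIV"
    and "real_analytic \<Phi>"
    and "bdd_below (range \<Phi>)"
    and "filterlim \<Phi> at_top at_top"
  shows "dim {F x | F. F \<in> zero_time_ideal (chain_drift n e (deriv \<Phi>)) (first_particle_force e)}
           = 2 * n"
proof -
  have diff: "(deriv ^^ i) (deriv \<Phi>) field_differentiable (at r)" for i r
    by (intro real_analytic_differentiable real_analytic_higher_deriv real_analytic_deriv assms)
  have "\<forall>k. \<exists>i. (deriv ^^ Suc i) (deriv \<Phi>) (gap e k x) \<noteq> 0"
    by (intro allI potential_higher_deriv_nonzero assms)
  then obtain j where j: "\<And>k. (deriv ^^ Suc (j k)) (deriv \<Phi>) (gap e k x) \<noteq> 0"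
    by metis
  \<comment> \<open>The orders were fixed at \<open>x\<close>; by continuity the same derivatives
    remain nonzero nearby, and finitely many open conditions leave an open set.\<close>
  define U where "U = (\<Inter>k\<in>{1..<n}. {y. (deriv ^^ Suc (j k)) (deriv \<Phi>) (gap e k y) \<noteq> 0})"
  have "continuous_on UNIV (\<lambda>y. (deriv ^^ Suc (j k)) (deriv \<Phi>) (gap e k y))" for k
    by (rule continuous_on_compose2[of UNIV "(deriv ^^ Suc (j k)) (deriv \<Phi>)"])
      (auto intro!: continuous_at_imp_continuous_on field_differentiable_imp_continuous_at
        diff[of "Suc _", simplified] linear_continuous_on[OF bounded_linear_gap])
  then have "open U"
    unfolding U_def by (intro open_INT ballI open_Collect_neq) auto
  moreover have "x \<in> U"
    using j by (auto simp: U_def)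
  moreover have "nondegenerate_chain n e (deriv \<Phi>) U j"
    using assms(1,2) diff \<open>open U\<close> by unfold_locales (auto simp: U_def)
  ultimately have "{F x |F. F \<in> zero_time_ideal (chain_drift n e (deriv \<Phi>)) (first_particle_force e)} = UNIV"
    by (intro nondegenerate_chain.ideal_values_eq_UNIV)
  \<comment> \<open>The phase space has dimension \<open>2 * CARD('n)\<close>, which the numbering
    of the particles turns into \<open>2 * n\<close>.\<close>
  moreover have "CARD('n) = n"
    using bij_betw_same_card[OF assms(2)] by simp
  ultimately show ?thesis
    by simp
qed

end
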